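(* Let $n\geq 1$ be an integer, let $h:[0,1]^n\to\mathbb{R}$ be a linear combination of $n$-place lattice polynomials, let $\mathbf{X}$ be a random vector uniformly distributed on $[0,1]^n$, and set $Y_h:=h(\mathbf{X})$. For $A\subseteq[n]:=\{1,\ldots,n\}$ put $v_h(A):=h(\mathbf{1}_A)$. Then, for any integer $r\geq 1$, setting $A_0:=[n]$, $$\mathbf{E}[Y_h^r]=\frac{1}{\binom{n+r}{r}}\sum_{\substack{A_1\subseteq [n]\\ A_2\subseteq A_1\\ \cdots\\ A_r\subseteq A_{r-1}}}\ \prod_{i=1}^r\frac{1}{\binom{|A_{i-1}|}{|A_i|}}\,v_h(A_i),$$ where the sum ranges over all sequences $(A_1,\ldots,A_r)$ of subsets of $[n]$ with $A_r\subseteq A_{r-1}\subseteq\cdots\subseteq A_1\subseteq[n]$.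
   Context: An $n$-place lattice polynomial is a function $p:[0,1]^n\to[0,1]$ given by a well-formed expression in the variables $x_1,\ldots,x_n$ built using only $\wedge=\min$, $\vee=\max$ and parentheses (no constants), e.g. $(x_1\wedge x_2)\vee x_3$. A linear combination of lattice polynomials is a function $h=\sum_{i=1}^m c_i\,p_i$ with $c_i\in\mathbb{R}$ and $p_i$ $n$-place lattice polynomials. On each simplex $S_\sigma:=\{\mathbf{x}\in[0,1]^n: x_{\sigma(1)}\geq\cdots\geq x_{\sigma(n)}\}$ ($\sigma$ a permutation of $[n]$) such an $h$ is given by $h(\mathbf{x})=\sum_{i=1}^n(h_i^\sigma-h_{i-1}^\sigma)\,x_{\sigma(i)}$, where $h_i^\sigma:=h(\mathbf{1}_{\{\sigma(1),\ldots,\sigma(i)\}})$; in particular $h_0^\sigma=h(\mathbf{0})=0$. For $A\subseteq[n]$, $\mathbf{1}_A\in\{0,1\}^n$ is the characteristic vector of $A$. *)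

theory Defs
  imports "HOL-Probability.Probability"
begin

text \<open>A vector with real entries indexed by \<open>{1..n}\<close> is an extensional function on \<open>{1..n}\<close>, i.e.
  a point of the product space \<open>\<Pi>\<^sub>M i\<in>{1..n}. lborel\<close>.\<close>

definition cube :: "nat \<Rightarrow> (nat \<Rightarrow> real) set" where
  "cube n = {1..n} \<rightarrow>\<^sub>E {0..1}"

definition char_vec :: "nat \<Rightarrow> nat set \<Rightarrow> nat \<Rightarrow> real" where
  "char_vec n A = (\<lambda>i\<in>{1..n}. indicator A i)"

datatype lattice_expr =
    Var nat
  | Meet lattice_expr lattice_expr
  | Join lattice_expr lattice_expr

fun vars :: "lattice_expr \<Rightarrow> nat set" where
  "vars (Var i) = {i}"
| "vars (Meet s t) = vars s \<union> vars t"
| "vars (Join s t) = vars s \<union> vars t"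

fun eval_expr :: "lattice_expr \<Rightarrow> (nat \<Rightarrow> real) \<Rightarrow> real" where
  "eval_expr (Var i) x = x i"
| "eval_expr (Meet s t) x = min (eval_expr s x) (eval_expr t x)"
| "eval_expr (Join s t) x = max (eval_expr s x) (eval_expr t x)"

text \<open>Functions on \<open>[0,1]\<^sup>n\<close> are total functions of which only the values on \<^term>\<open>cube n\<close> matter.\<close>

definition lattice_polynomial :: "nat \<Rightarrow> ((nat \<Rightarrow> real) \<Rightarrow> real) \<Rightarrow> bool" where
  "lattice_polynomial n p \<longleftrightarrow> (\<exists>e. vars e \<subseteq> {1..n} \<and> (\<forall>x\<in>cube n. p x = eval_expr e x))"

definition lincomb_lattice_polynomials :: "nat \<Rightarrow> ((nat \<Rightarrow> real) \<Rightarrow> real) \<Rightarrow> bool" where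
  "lincomb_lattice_polynomials n h \<longleftrightarrow>
     (\<exists>(m::nat) (c :: nat \<Rightarrow> real) p. (\<forall>i\<in>{1..m}. lattice_polynomial n (p i)) \<and>
        (\<forall>x\<in>cube n. h x = (\<Sum>i=1..m. c i * p i x)))"

definition set_fun :: "nat \<Rightarrow> ((nat \<Rightarrow> real) \<Rightarrow> real) \<Rightarrow> nat set \<Rightarrow> real" where
  "set_fun n h A = h (char_vec n A)"

text \<open>The values of \<open>X\<close> are required to lie in the cube everywhere, not just almost surely, since
  a function \<open>h\<close> on the cube may be arbitrary (even non-measurable) outside of it.\<close>

definition uniform_on_cube :: "nat \<Rightarrow> 'a measure \<Rightarrow> ('a \<Rightarrow> nat \<Rightarrow> real) \<Rightarrow> bool" where
  "uniform_on_cube n M X \<longleftrightarrow>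
     X \<in> M \<rightarrow>\<^sub>M (\<Pi>\<^sub>M i\<in>{1..n}. lborel) \<and>
     X \<in> space M \<rightarrow> cube n \<and>
     distr M (\<Pi>\<^sub>M i\<in>{1..n}. lborel) X = uniform_measure (\<Pi>\<^sub>M i\<in>{1..n}. lborel) (cube n)"

text \<open>Sequences \<open>A\<^sub>1 \<supseteq> \<dots> \<supseteq> A\<^sub>r\<close> of subsets of \<open>{1..n}\<close>, extended by \<open>A\<^sub>0 = {1..n}\<close>;
  extensionality makes the set finite and each sequence occur once.\<close>

definition subset_chains :: "nat \<Rightarrow> nat \<Rightarrow> (nat \<Rightarrow> nat set) set" where
  "subset_chains n r =
     {A \<in> {0..r} \<rightarrow>\<^sub>E Pow {1..n}. A 0 = {1..n} \<and> (\<forall>i\<in>{1..r}. A i \<subseteq> A (i - 1))}"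

end

(* A lattice polynomial p commutes with thresholding: p x >= s iff p takes the value 1 at the
   characteristic vector of {i. x i >= s}. By linearity h x is the integral over s in [0,1] of
   v_h {i. x i >= s}. Writing H_t for the same integral over [t,1], the fundamental theorem of
   calculus turns H_t^(r+1) into (r+1) times the integral over s in [t,1] of
   v_h {i. x i >= s} * H_s^r. Integrate this over a box on which {i. x i >= t} = D
   and split it into the smaller boxes on which {i. x i >= s} = E with E a subset of D: the volumes
   are products of powers of s - t and 1 - s, so integrating over s gives a recursion in r whose
   coefficients are Beta integrals. Unrolling it gives the sum over chains. *)
theory Submission
  imports Defs
begin

section \<open>Level sets, tail integrals and chains\<close>

definition level_set :: "nat set \<Rightarrow> real \<Rightarrow> (nat \<Rightarrow> real) \<Rightarrow> nat set" where
  "level_set I s x = {i\<in>I. s \<le> x i}"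

text \<open>The lower limit \<open>t\<close> is a parameter because each step of the recursion on
  the exponent restarts at a higher threshold. For \<open>v = set_fun n h\<close> and
  \<open>t = 0\<close> this recovers \<open>h\<close> on the cube.\<close>

definition level_integral :: "nat set \<Rightarrow> (nat set \<Rightarrow> real) \<Rightarrow> real \<Rightarrow> (nat \<Rightarrow> real) \<Rightarrow> real" where
  "level_integral I v t x = (\<integral>s. indicator {t..1} s * v (level_set I s x) \<partial>lborel)"

text \<open>The weighted sum over chains with top set \<open>D\<close>, organised by the choice of
  the next set \<open>E\<close>; the recursion over boxes produces it in this form.\<close>

primrec chain_sum :: "(nat set \<Rightarrow> real) \<Rightarrow> nat \<Rightarrow> nat set \<Rightarrow> real" where
  "chain_sum v 0 D = 1"
| "chain_sum v (Suc r) D =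
     (\<Sum>E\<in>Pow D. v E / real (card D choose card E) * chain_sum v r E)"

text \<open>\<open>subset_chains\<close> with an arbitrary top set: dropping the top of a chain
  leaves a chain below its second member.\<close>

definition chains_below :: "nat set \<Rightarrow> nat \<Rightarrow> (nat \<Rightarrow> nat set) set" where
  "chains_below D r =
     {A \<in> {0..r} \<rightarrow>\<^sub>E Pow D. A 0 = D \<and> (\<forall>i\<in>{1..r}. A i \<subseteq> A (i - 1))}"

section \<open>Summation over chains\<close>

lemma finite_chains_below: "finite D \<Longrightarrow> finite (chains_below D r)"
  unfolding chains_below_def
  by (rule finite_subset[OF _ finite_PiE[of "{0..r}" "\<lambda>_. Pow D"]]) auto

text \<open>A chain with \<open>Suc r\<close> steps below \<open>D\<close> amounts to a first step
  to some \<open>E \<subseteq> D\<close> followed by a chain with \<open>r\<close> steps below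
  \<open>E\<close>, and the weights multiply along the chain.\<close>

lemma sum_chains_below:
  assumes "finite D"
  shows "(\<Sum>A\<in>chains_below D r. \<Prod>i=1..r. 1 / real (card (A (i - 1)) choose card (A i)) * v (A i))
    = chain_sum v r D"
  using assms
proof (induction r arbitrary: D)
  case 0
  have "chains_below D 0 = {\<lambda>i. if i = 0 then D else undefined}"
    by (auto simp: chains_below_def PiE_def extensional_def fun_eq_iff)
  then show ?case by simp
next
  case (Suc r)
  define w where "w r A = (\<Prod>i=1..r. 1 / real (card (A (i - 1)) choose card (A i)) * v (A i))"
    for r and A :: "nat \<Rightarrow> nat set"
  \<comment> \<open>\<open>attach\<close> puts \<open>D\<close> in front and shifts the indices up
    by one; \<open>detach\<close> undoes this. Both return \<open>undefined\<close> beyond the last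
    index, as extensionality demands.\<close>
  define attach :: "nat set \<times> (nat \<Rightarrow> nat set) \<Rightarrow> nat \<Rightarrow> nat set" where
    "attach = (\<lambda>(E, A) i. if i = 0 then D else if i \<le> Suc r then A (i - 1) else undefined)"
  define detach :: "(nat \<Rightarrow> nat set) \<Rightarrow> nat set \<times> (nat \<Rightarrow> nat set)" where
    "detach = (\<lambda>A. (A 1, \<lambda>i. if i \<le> r then A (Suc i) else undefined))"
  have "chain_sum v r E = (\<Sum>A\<in>chains_below E r. w r A)" if "E \<in> Pow D" for E
    unfolding w_def using that Suc.prems finite_subset[of E D] by (intro Suc.IH[symmetric]) auto
  then have "chain_sum v (Suc r) D = (\<Sum>E\<in>Pow D. \<Sum>A\<in>chains_below E r. v E / real (card D choose card E) * w r A)"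
    by (simp add: sum_distrib_left)
  also have "\<dots> = (\<Sum>(E, A)\<in>(SIGMA E:Pow D. chains_below E r). v E / real (card D choose card E) * w r A)"
    using Suc.prems by (intro sum.Sigma) (auto intro: finite_chains_below finite_subset)
  also have "\<dots> = (\<Sum>A\<in>chains_below D (Suc r). w (Suc r) A)"
  proof (rule sum.reindex_bij_witness[where i = detach and j = attach])
    fix p assume p: "p \<in> (SIGMA E:Pow D. chains_below E r)"
    obtain E A where pE: "p = (E, A)" by force
    then have E: "E \<subseteq> D" and A: "\<And>i. i \<le> r \<Longrightarrow> A i \<subseteq> E" "A 0 = E"
        "\<And>i. i > r \<Longrightarrow> A i = undefined" "\<And>i. 1 \<le> i \<Longrightarrow> i \<le> r \<Longrightarrow> A i \<subseteq> A (i - 1)"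
      using p by (auto simp: chains_below_def PiE_def extensional_def Pi_def)
    let ?B = "(\<lambda>i. if i = 0 then D else if i \<le> Suc r then A (i - 1) else undefined)"
    have j: "attach p = ?B"
      by (simp add: pE attach_def)
    show "detach (attach p) = p"
      unfolding j unfolding pE detach_def using A by (auto simp: fun_eq_iff not_le)
    \<comment> \<open>The inclusion at \<open>i = 1\<close> is \<open>E \<subseteq> D\<close>; the
      later ones come from \<open>A\<close> with the index lowered by one.\<close>
    have le: "?B i \<subseteq> ?B (i - 1)" if "i \<in> {1..Suc r}" for i
    proof (cases "i = 1")
      case True
      then show ?thesis using A E by auto
    next
      case False
      then have "A (i - 1) \<subseteq> A (i - 1 - 1)" using that by (intro A(4)) auto
      then show ?thesis using False that by (auto simp: le_diff_conv)
    qed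
    show "attach p \<in> chains_below D (Suc r)"
      unfolding j chains_below_def
    proof (intro CollectI conjI PiE_I ballI le)
      show "?B i \<in> Pow D" if "i \<in> {0..Suc r}" for i
        using A(1)[of "i - 1"] E that by (auto simp: le_diff_conv)
    qed auto
    \<comment> \<open>Starting the product at 0 isolates the factor for the step from
      \<open>D\<close> to \<open>E\<close>.\<close>
    have "w (Suc r) ?B = (\<Prod>i=0..r. 1 / real (card (?B i) choose card (?B (Suc i))) * v (?B (Suc i)))"
      unfolding w_def by (subst One_nat_def, subst prod.shift_bounds_cl_Suc_ivl) (simp only: diff_Suc_1)
    also have "\<dots> = v E / real (card D choose card E) *
        (\<Prod>i=1..r. 1 / real (card (?B i) choose card (?B (Suc i))) * v (?B (Suc i)))"
      using A by (subst prod.atLeast_Suc_atMost) auto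
    also have "\<dots> = v E / real (card D choose card E) * w r A"
      unfolding w_def by (intro arg_cong2[where f = "(*)"] refl prod.cong) auto
    finally show "w (Suc r) (attach p)
        = (case p of (E, A) \<Rightarrow> v E / real (card D choose card E) * w r A)"
      unfolding j by (simp add: pE)
  next
    fix B assume B: "B \<in> chains_below D (Suc r)"
    then have B1: "\<And>i. i \<le> Suc r \<Longrightarrow> B i \<subseteq> D" "B 0 = D"
      "\<And>i. i > Suc r \<Longrightarrow> B i = undefined"
      by (auto simp: chains_below_def PiE_def extensional_def Pi_def)
    have B2: "B (Suc i) \<subseteq> B i" if "i \<le> r" for i
    proof -
      have "\<forall>i\<in>{1..Suc r}. B i \<subseteq> B (i - 1)" using B by (simp add: chains_below_def)
      from bspec[OF this, of "Suc i"] that show ?thesis by simp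
    qed
    \<comment> \<open>The detached tail has to consist of subsets of its own top set
      \<open>B 1\<close>, not merely of \<open>D\<close>.\<close>
    have "B (Suc i) \<subseteq> B (Suc 0)" if "i \<le> r" for i
      using that by (induction i) (use B2 in fastforce)+
    moreover have "B (Suc i) \<subseteq> B (Suc (i - Suc 0))" if "Suc 0 \<le> i" "i \<le> r" for i
      using B2[of i] that by simp
    ultimately show "detach B \<in> (SIGMA E:Pow D. chains_below E r)"
      using B1 by (auto simp: detach_def chains_below_def PiE_def extensional_def Pi_def)
    show "attach (detach B) = B"
      using B1 by (auto simp: attach_def detach_def fun_eq_iff)
  qed
  finally show ?case by (simp add: w_def)
qed

section \<open>Beta integrals and binomial coefficients\<close>

text \<open>Integration by parts trades a power of \<open>1 - s\<close> for a power of
  \<open>s - t\<close>, so the induction on \<open>b\<close> leaves \<open>a\<close> free. Both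
  boundary terms vanish, since one factor is zero at each endpoint.\<close>

lemma beta_integral:
  fixes t :: real
  assumes "t \<le> 1"
  shows "(\<integral>s. (s - t) ^ a * (1 - s) ^ b * indicator {t..1} s \<partial>lborel) =
    fact a * fact b / fact (a + b + 1) * (1 - t) ^ (a + b + 1)"
proof (induction b arbitrary: a)
  case 0
  have "(\<integral>s. (s - t) ^ a * indicator {t..1} s \<partial>lborel)
      = (1 - t) ^ Suc a / Suc a - (t - t) ^ Suc a / Suc a"
    using assms
    by (intro integral_FTC_Icc_real) (auto intro!: derivative_eq_intros simp del: power_Suc of_nat_Suc)
  then have "(\<integral>s. (s - t) ^ a * indicator {t..1} s \<partial>lborel) = (1 - t) ^ Suc a / Suc a"
    by (simp only: diff_self power_0_Suc)
  then show ?case by simp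
next
  case (Suc b)
  have "(\<integral>s. (1 - s) ^ Suc b * (s - t) ^ a * indicator {t..1} s \<partial>lborel)
      = (1 - 1) ^ Suc b * ((1 - t) ^ Suc a / Suc a) - (1 - t) ^ Suc b * ((t - t) ^ Suc a / Suc a)
        - (\<integral>s. - (real (Suc b) * (1 - s) ^ b) * ((s - t) ^ Suc a / Suc a) * indicator {t..1} s \<partial>lborel)"
    using assms
    by (intro integral_by_parts) (auto intro!: derivative_eq_intros continuous_intros simp del: power_Suc of_nat_Suc)
  also have "\<dots> = - (\<integral>s. - (Suc b / Suc a) * ((s - t) ^ Suc a * (1 - s) ^ b * indicator {t..1} s) \<partial>lborel)"
    by (simp add: mult_ac)
  also have "\<dots> = real (Suc b) / real (Suc a) *
      (fact (Suc a) * fact b / fact (Suc a + b + 1) * (1 - t) ^ (Suc a + b + 1))"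
    by (subst integral_mult_right_zero) (subst Suc.IH, simp)
  also have "\<dots> = fact a * fact (Suc b) / fact (a + Suc b + 1) * (1 - t) ^ (a + Suc b + 1)"
    by (simp add: fact_Suc[of a] fact_Suc[of b] field_simps del: of_nat_Suc power_Suc fact_Suc)
  finally show ?case by (simp only: mult_ac)
qed

text \<open>After \<open>fact (e + r)\<close> cancels, both sides equal (r+1)! e! (d-e)! / (d+r+1)!.
  This rewrites the Beta constant of one recursion step as the chain weight
  \<open>1 / (d choose e)\<close> times the normalisation for the exponent
  \<open>Suc r\<close>.\<close>

lemma chain_coefficient:
  fixes d e r :: nat
  assumes "e \<le> d"
  shows "real (Suc r) * (fact (d - e) * fact (e + r) / fact (d - e + (e + r) + 1)) / real ((e + r) choose r)
    = 1 / real (d choose e) / real ((d + Suc r) choose Suc r)"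
proof -
  have "real ((e + r) choose r) = fact (e + r) / (fact r * fact e)"
    "real (d choose e) = fact d / (fact e * fact (d - e))"
    "real ((d + Suc r) choose Suc r) = fact (d + Suc r) / (fact (Suc r) * fact d)"
    using assms by (subst binomial_fact; simp)+
  moreover have "d - e + (e + r) + 1 = d + Suc r" using assms by simp
  ultimately show ?thesis
    by (simp only: fact_Suc[of r]) (simp add: field_simps del: of_nat_Suc fact_Suc binomial_Suc_Suc)
qed

section \<open>Thresholding lattice polynomials\<close>

lemma eval_expr_in_unit:
  assumes "x \<in> cube n" "vars e \<subseteq> {1..n}"
  shows "eval_expr e x \<in> {0..1}"
  using assms(2) by (induction e) (use assms(1) in \<open>auto simp: cube_def PiE_iff min_def max_def\<close>)

lemma char_vec_in_cube: "char_vec n A \<in> cube n"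
  by (auto simp: char_vec_def cube_def)

text \<open>The map sending a to \<open>of_bool (s \<le> a)\<close> is nondecreasing and therefore
  commutes with \<open>min\<close> and \<open>max\<close>.\<close>

lemma eval_expr_level_set:
  assumes "vars e \<subseteq> {1..n}"
  shows "eval_expr e (char_vec n (level_set {1..n} s x)) = of_bool (s \<le> eval_expr e x)"
  using assms by (induction e) (auto simp: char_vec_def level_set_def indicator_def)

text \<open>Layer-cake formula: a value in [0,1] is the length of the set of thresholds in [0,1]
  that it reaches. Thresholding moves this condition into the argument of each polynomial, and
  linearity does the rest.\<close>

lemma lincomb_eq_level_integral:
  assumes h: "lincomb_lattice_polynomials n h" and x: "x \<in> cube n"
  shows "h x = level_integral {1..n} (set_fun n h) 0 x"
proof -
  obtain m :: nat and c p where p: "\<forall>i\<in>{1..m}. lattice_polynomial n (p i)"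
    and hx: "\<forall>x\<in>cube n. h x = (\<Sum>i=1..m. c i * p i x)"
    using h unfolding lincomb_lattice_polynomials_def by blast
  from p obtain e where e: "\<And>i. i \<in> {1..m} \<Longrightarrow> vars (e i) \<subseteq> {1..n}"
    "\<And>i x. i \<in> {1..m} \<Longrightarrow> x \<in> cube n \<Longrightarrow> p i x = eval_expr (e i) x"
    unfolding lattice_polynomial_def by metis
  have "level_integral {1..n} (set_fun n h) 0 x =
      (\<integral>s. (\<Sum>i=1..m. c i * indicator {0..eval_expr (e i) x} s) \<partial>lborel)"
    unfolding level_integral_def
  proof (intro Bochner_Integration.integral_cong refl)
    fix s :: real
    have "set_fun n h (level_set {1..n} s x) = (\<Sum>i=1..m. c i * of_bool (s \<le> eval_expr (e i) x))"
      unfolding set_fun_def using hx char_vec_in_cube e(2)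
      by (auto simp: eval_expr_level_set[OF e(1)] simp del: sum_mult_of_bool_eq One_nat_def intro!: sum.cong)
    \<comment> \<open>The polynomials have values at most 1, so restricting the thresholds to [0,1]
      loses nothing.\<close>
    moreover have "indicator {0..1} s * of_bool (s \<le> eval_expr (e i) x)
       = (indicator {0..eval_expr (e i) x} s :: real)" if "i \<in> {1..m}" for i
      using eval_expr_in_unit[OF x e(1)[OF that]] by (auto simp: indicator_def)
    ultimately show "indicator {0..1} s * set_fun n h (level_set {1..n} s x)
        = (\<Sum>i=1..m. c i * indicator {0..eval_expr (e i) x} s)"
      by (simp only: sum_distrib_left mult.left_commute[of "indicator {0..1} s" "c _"]) (auto intro!: sum.cong)
  qed
  also have "\<dots> = (\<Sum>i=1..m. c i * eval_expr (e i) x)"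
  proof -
    have "(\<integral>s. indicator {0..eval_expr (e i) x} s \<partial>lborel) = eval_expr (e i) x" if "i \<in> {1..m}" for i
      using eval_expr_in_unit[OF x e(1)[OF that]] by simp
    then show ?thesis
      by (subst Bochner_Integration.integral_sum) (auto simp: integrable_real_indicator emeasure_lborel_Icc_eq)
  qed
  also have "\<dots> = h x" using hx x e by simp
  finally show ?thesis ..
qed

section \<open>Regularity, measurability and bounds\<close>

text \<open>Away from the coordinates of \<open>x\<close>, each comparison with \<open>x i\<close>
  keeps its truth value near \<open>s\<close>, so the level set is locally constant. The finitely
  many remaining points form the exceptional set for the fundamental theorem of calculus.\<close>

lemma continuous_level_set:
  assumes "finite I" "s \<notin> x ` I"
  shows "isCont (\<lambda>s. v (level_set I s x) :: real) s"
proof -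
  have "\<forall>\<^sub>F u in nhds s. \<forall>i\<in>I. (u \<le> x i) = (s \<le> x i)"
    unfolding eventually_ball_finite_distrib[OF assms(1)]
  proof
    fix i assume i: "i \<in> I"
    then consider "s < x i" | "s > x i" using assms(2) by fastforce
    then show "\<forall>\<^sub>F u in nhds s. (u \<le> x i) = (s \<le> x i)"
    proof cases
      case 1
      then show ?thesis
        using order_tendstoD(2)[OF filterlim_ident 1] by (auto elim: eventually_mono)
    next
      case 2
      then show ?thesis
        using order_tendstoD(1)[OF filterlim_ident 2] by (auto elim: eventually_mono)
    qed
  qed
  then have "\<forall>\<^sub>F u in nhds s. v (level_set I u x) = v (level_set I s x)"
    by eventually_elim (auto simp: level_set_def intro!: arg_cong[where f = v])
  then show ?thesis
    by (subst isCont_cong[where g = "\<lambda>_. v (level_set I s x)"]) auto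
qed

text \<open>Only the term with \<open>E\<close> equal to the level set survives. For an arbitrary
  set function \<open>v\<close>, measurability can be read off from this finite sum of products of
  conditions on single coordinates.\<close>

lemma level_set_expansion:
  fixes v :: "nat set \<Rightarrow> real"
  assumes "finite I"
  shows "v (level_set I s x) = (\<Sum>E\<in>Pow I. v E * (\<Prod>i\<in>I. if (s \<le> x i) = (i \<in> E) then 1 else 0))"
proof -
  have "(\<Prod>i\<in>I. if (s \<le> x i) = (i \<in> E) then 1 else 0) = (if level_set I s x = E then 1 else 0 :: real)"
    if "E \<in> Pow I" for E
    using assms that by (auto simp: level_set_def prod_zero_iff)
  then have "(\<Sum>E\<in>Pow I. v E * (\<Prod>i\<in>I. if (s \<le> x i) = (i \<in> E) then 1 else 0))
     = (\<Sum>E\<in>Pow I. if level_set I s x = E then v E else 0)"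
    by (intro sum.cong refl) auto
  also have "\<dots> = v (level_set I s x)"
    using assms by (subst sum.delta') (auto simp: level_set_def)
  finally show ?thesis ..
qed

lemma measurable_level_set_pair [measurable]:
  assumes "finite I"
  shows "(\<lambda>(x, s). v (level_set I s x) :: real) \<in> borel_measurable ((\<Pi>\<^sub>M i\<in>I. lborel) \<Otimes>\<^sub>M lborel)"
  unfolding level_set_expansion[OF assms] case_prod_beta
  by (intro borel_measurable_sum borel_measurable_times borel_measurable_prod measurable_If) measurable

lemma measurable_level_set [measurable]:
  assumes "finite I"
  shows "(\<lambda>s. v (level_set I s x) :: real) \<in> borel_measurable borel"
  unfolding level_set_expansion[OF assms]
  by (intro borel_measurable_sum borel_measurable_times borel_measurable_prod measurable_If) measurable

text \<open>This bound is uniform in \<open>s\<close> and \<open>x\<close>; with it, the integrands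
  below are bounded functions on sets of finite measure.\<close>

lemma abs_level_set_le:
  fixes v :: "nat set \<Rightarrow> real"
  assumes "finite I"
  shows "\<bar>v (level_set I s x)\<bar> \<le> (\<Sum>E\<in>Pow I. \<bar>v E\<bar>)"
  using assms by (intro member_le_sum[of _ _ "\<lambda>E. \<bar>v E\<bar>"]) (auto simp: level_set_def)

text \<open>Measurability jointly in the point and the lower limit is what Fubini's theorem
  requires.\<close>

lemma measurable_level_integral [measurable]:
  assumes [simp]: "finite I"
  shows "(\<lambda>(x, s). level_integral I v s x) \<in> borel_measurable ((\<Pi>\<^sub>M i\<in>I. lborel) \<Otimes>\<^sub>M lborel)"
proof -
  let ?P = "(\<Pi>\<^sub>M i\<in>I. lborel) \<Otimes>\<^sub>M (lborel :: real measure)"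
  have [measurable]: "(\<lambda>z. v (level_set I (snd z) (fst (fst z)))) \<in> borel_measurable (?P \<Otimes>\<^sub>M (lborel :: real measure))"
    using measurable_compose[OF _ measurable_level_set_pair[OF assms],
        of "\<lambda>z. (fst (fst z), snd z)" "?P \<Otimes>\<^sub>M (lborel :: real measure)"] by simp
  show ?thesis
    unfolding level_integral_def case_prod_beta indicator_def atLeastAtMost_iff by measurable
qed

lemma level_set_integrable:
  assumes "finite I"
  shows "set_integrable lborel {s..1} (\<lambda>u. v (level_set I u x) :: real)"
  unfolding set_integrable_def using assms
  by (intro integrableI_bounded_set[where A = "{s..1}" and B = "\<Sum>E\<in>Pow I. \<bar>v E\<bar>"])
    (auto simp: indicator_def abs_level_set_le emeasure_lborel_Icc_eq)

text \<open>The fundamental theorem of calculus is applied to the Henstock-Kurzweil integral and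
  Fubini's theorem to the Lebesgue integral; here the two agree.\<close>

lemma level_integral_HK:
  assumes "finite I"
  shows "level_integral I v s x = integral {s..1} (\<lambda>u. v (level_set I u x))"
    "(\<lambda>u. v (level_set I u x)) integrable_on {s..1}"
  using set_borel_integral_eq_integral[OF level_set_integrable[OF assms, of s v x]]
  by (auto simp: level_integral_def set_lebesgue_integral_def)

lemma abs_level_integral_le:
  assumes "finite I" "0 \<le> s" "s \<le> 1"
  shows "\<bar>level_integral I v s x\<bar> \<le> (\<Sum>E\<in>Pow I. \<bar>v E\<bar>)"
proof -
  have "norm (integral {s..1} (\<lambda>u. v (level_set I u x))) \<le> (\<Sum>E\<in>Pow I. \<bar>v E\<bar>) * (1 - s)"
    using has_integral_bound_real[OF _ finite.emptyI integrable_integral[OF level_integral_HK(2)[OF assms(1), of v x s]],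
        of "\<Sum>E\<in>Pow I. \<bar>v E\<bar>"] abs_level_set_le[OF assms(1)] assms(3)
    by (auto simp: sum_nonneg)
  also have "\<dots> \<le> (\<Sum>E\<in>Pow I. \<bar>v E\<bar>)"
    using assms by (simp add: mult_left_le sum_nonneg)
  finally show ?thesis by (simp add: level_integral_HK(1)[OF assms(1)])
qed

lemma measurable_level_integral1 [measurable]:
  assumes "finite I"
  shows "(\<lambda>s. level_integral I v s x) \<in> borel_measurable borel"
proof -
  have [measurable]: "(\<lambda>z. v (level_set I (snd z) x)) \<in> borel_measurable ((borel :: real measure) \<Otimes>\<^sub>M (lborel :: real measure))"
    using measurable_compose[OF _ measurable_level_set[OF assms], of snd "borel \<Otimes>\<^sub>M lborel"] by simp
  show ?thesis
    unfolding level_integral_def indicator_def atLeastAtMost_iff by measurable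
qed

section \<open>Powers of tail integrals\<close>

text \<open>With G the tail integral of \<open>f\<close>, the derivative of G is \<open>- f\<close>
  wherever \<open>f\<close> is continuous, so the integrand is the derivative of -G^(r+1) outside a
  finite set.\<close>

lemma has_integral_power_tail_integral:
  fixes f :: "real \<Rightarrow> real"
  assumes f: "f integrable_on {a..b}" and "a \<le> b" and "finite S"
    and cont: "\<And>s. s \<in> {a<..<b} - S \<Longrightarrow> isCont f s"
  shows "((\<lambda>s. real (Suc r) * (f s * integral {s..b} f ^ r)) has_integral integral {a..b} f ^ Suc r) {a..b}"
proof -
  define G where "G s = integral {s..b} f" for s
  have G: "G s = integral {a..b} f - integral {a..s} f" if "s \<in> {a..b}" for s
    using Henstock_Kurzweil_Integration.integral_combine[of a s b f] that f by (simp add: G_def)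
  \<comment> \<open>A finite exceptional set is harmless only if the antiderivative is continuous on
    the whole closed interval.\<close>
  have contG: "continuous_on {a..b} G"
  proof (rule continuous_on_eq)
    show "continuous_on {a..b} (\<lambda>s. integral {a..b} f - integral {a..s} f)"
      by (intro continuous_on_diff continuous_on_const indefinite_integral_continuous_1 f)
  qed (simp add: G)
  have deriv: "(G has_real_derivative - f s) (at s)" if s: "s \<in> {a<..<b} - S" for s
  proof -
    have "((\<lambda>u. integral {a..u} f) has_vector_derivative f s) (at s within {a..b} - {})"
      using s by (intro integral_has_vector_derivative_continuous_at[OF f]
          continuous_at_imp_continuous_at_within[OF cont[OF s]]) simp_all
    moreover have "at s within {a..b} = at s"
      using s by (intro at_within_Icc_at) auto
    ultimately have "((\<lambda>u. integral {a..u} f) has_real_derivative f s) (at s)"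
      by (simp add: has_real_derivative_iff_has_vector_derivative)
    from DERIV_diff[OF DERIV_const[of "integral {a..b} f"] this]
    have "((\<lambda>u. integral {a..b} f - integral {a..u} f) has_real_derivative - f s) (at s)"
      by simp
    then show ?thesis
      by (rule has_field_derivative_transform_within_open[of _ _ _ "{a<..<b}"]) (use s G in auto)
  qed
  have "((\<lambda>s. - (G s ^ Suc r)) has_vector_derivative real (Suc r) * (f s * G s ^ r)) (at s)"
    if "s \<in> {a<..<b} - S" for s
    unfolding has_real_derivative_iff_has_vector_derivative[symmetric]
    by (rule DERIV_cong[OF DERIV_minus[OF DERIV_power[OF deriv[OF that]]]]) (simp del: of_nat_Suc)
  then have "((\<lambda>s. real (Suc r) * (f s * G s ^ r)) has_integral (- (G b ^ Suc r) - - (G a ^ Suc r))) {a..b}"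
    using assms(2,3)
    by (intro fundamental_theorem_of_calculus_interior_strong[of S] continuous_on_minus
        continuous_on_power contG)
  \<comment> \<open>\<open>G b\<close> is an integral over a single point, so only the boundary term
    at \<open>a\<close> remains.\<close>
  then show ?thesis by (simp add: G_def)
qed

lemma level_integral_power:
  assumes "finite I" "0 \<le> t" "t \<le> 1"
  shows "level_integral I v t x ^ Suc r =
    (\<integral>s. indicator {t..1} s * (real (Suc r) * (v (level_set I s x) * level_integral I v s x ^ r)) \<partial>lborel)"
proof -
  let ?K = "\<Sum>E\<in>Pow I. \<bar>v E\<bar>"
  define f where "f = (\<lambda>s. v (level_set I s x))"
  define G where "G = (\<lambda>s. level_integral I v s x)"
  define g where "g = (\<lambda>s. real (Suc r) * (f s * G s ^ r))"
  have G: "G s = integral {s..1} f" for s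
    unfolding G_def f_def by (rule level_integral_HK(1)[OF assms(1)])
  have int: "f integrable_on {t..1}"
    unfolding f_def by (rule level_integral_HK(2)[OF assms(1)])
  have cont: "isCont f s" if "s \<in> {t<..<1} - x ` I" for s
    unfolding f_def using continuous_level_set[OF assms(1), of s x v] that by simp
  have hint: "(g has_integral G t ^ Suc r) {t..1}"
    unfolding g_def unfolding G by (rule has_integral_power_tail_integral[OF int assms(3) _ cont]) (use assms(1) in auto)
  have [measurable]: "f \<in> borel_measurable borel" "G \<in> borel_measurable borel"
    using measurable_level_set[OF assms(1), of v x] measurable_level_integral1[OF assms(1), of v x]
    by (simp_all add: f_def G_def)
  have "\<bar>f s * G s ^ r\<bar> \<le> ?K * ?K ^ r" if "s \<in> {t..1}" for s
  proof -
    have "\<bar>f s\<bar> \<le> ?K" unfolding f_def by (rule abs_level_set_le[OF assms(1)])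
    moreover have "\<bar>G s\<bar> \<le> ?K"
      unfolding G_def using that assms by (intro abs_level_integral_le) auto
    ultimately show ?thesis
      unfolding abs_mult power_abs by (intro mult_mono power_mono) (auto intro: sum_nonneg)
  qed
  then have bound: "\<bar>g s\<bar> \<le> real (Suc r) * (?K * ?K ^ r)" if "s \<in> {t..1}" for s
    unfolding g_def abs_mult[of "real (Suc r)"] using that by (intro mult_mono) auto
  \<comment> \<open>Boundedness makes \<open>g\<close> Lebesgue integrable, which turns the value in
    \<open>hint\<close> into a Lebesgue integral.\<close>
  have "set_integrable lborel {t..1} g"
    unfolding set_integrable_def
  proof (rule integrableI_bounded_set_indicator)
    show "g \<in> borel_measurable lborel" unfolding g_def by measurable
    show "AE s in lborel. s \<in> {t..1} \<longrightarrow> norm (g s) \<le> real (Suc r) * (?K * ?K ^ r)"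
      using bound by auto
  qed (use assms in auto)
  from set_borel_integral_eq_integral(2)[OF this]
  have "G t ^ Suc r = (\<integral>s. indicator {t..1} s * g s \<partial>lborel)"
    by (simp only: integral_unique[OF hint] set_lebesgue_integral_def real_scaleR_def)
  then show ?thesis by (simp only: g_def f_def G_def)
qed

section \<open>Integration over boxes\<close>

lemma measurable_level_integral_PiM [measurable]:
  assumes "finite I"
  shows "level_integral I v s \<in> borel_measurable (\<Pi>\<^sub>M i\<in>I. lborel)"
  using measurable_compose[OF measurable_Pair2' measurable_level_integral[OF assms], of s v] by simp

interpretation lborel_PiM: product_sigma_finite "\<lambda>_::nat. lborel :: real measure"
  by standard

lemma box_measurable:
  assumes "finite I" "\<And>i. i \<in> I \<Longrightarrow> S i \<in> sets borel"
  shows "PiE I S \<in> sets (\<Pi>\<^sub>M i\<in>I. lborel)"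
  using assms by (intro sets_PiM_I_finite) auto

lemma emeasure_unit_interval_subset: "S \<subseteq> {0..1::real} \<Longrightarrow> emeasure lborel S < top"
  by (rule le_less_trans[OF emeasure_mono[of _ "{0..1}"]]) auto

lemma box_emeasure:
  fixes S :: "nat \<Rightarrow> real set"
  assumes "finite I" "\<And>i. i \<in> I \<Longrightarrow> S i \<in> sets borel" "\<And>i. i \<in> I \<Longrightarrow> S i \<subseteq> {0..1}"
  shows "emeasure (\<Pi>\<^sub>M i\<in>I. lborel) (PiE I S) = ennreal (\<Prod>i\<in>I. measure lborel (S i))"
proof -
  have "emeasure lborel (S i) = ennreal (measure lborel (S i))" if "i \<in> I" for i
    using emeasure_unit_interval_subset[OF assms(3)[OF that]] by (intro emeasure_eq_ennreal_measure) simp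
  then show ?thesis
    using assms(1,2) by (simp add: lborel_PiM.emeasure_PiM prod_ennreal)
qed

lemma box_integrable:
  assumes "finite I" "\<And>i. i \<in> I \<Longrightarrow> S i \<in> sets borel" "\<And>i. i \<in> I \<Longrightarrow> S i \<subseteq> {0..1}" "0 \<le> s" "s \<le> 1"
  shows "integrable (\<Pi>\<^sub>M i\<in>I. lborel) (\<lambda>x. indicator (PiE I S) x * level_integral I v s x ^ r)"
proof (rule integrableI_bounded_set[where A = "PiE I S" and B = "(\<Sum>E\<in>Pow I. \<bar>v E\<bar>) ^ r"])
  note box_measurable[OF assms(1,2), measurable] and assms(1)[simp]
  show "PiE I S \<in> sets (\<Pi>\<^sub>M i\<in>I. lborel)" by (rule box_measurable[OF assms(1,2)])
  show "(\<lambda>x. indicator (PiE I S) x * level_integral I v s x ^ r) \<in> borel_measurable (\<Pi>\<^sub>M i\<in>I. lborel)"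
    by measurable
qed (use assms in \<open>auto intro!: power_mono abs_level_integral_le simp: power_abs box_emeasure\<close>)

text \<open>The power identity is inserted pointwise in \<open>x\<close>, and the order of
  integration is exchanged. The joint integrand is bounded and vanishes off the box times
  \<open>{t..1}\<close>, a set of finite measure.\<close>

lemma box_Fubini:
  assumes I: "finite I" and S: "\<And>i. i \<in> I \<Longrightarrow> S i \<in> sets borel" "\<And>i. i \<in> I \<Longrightarrow> S i \<subseteq> {0..1}"
    and t: "0 \<le> t" "t \<le> 1"
  shows "(\<integral>x. indicator (PiE I S) x * level_integral I v t x ^ Suc r \<partial>(\<Pi>\<^sub>M i\<in>I. lborel)) =
    (\<integral>s. indicator {t..1} s * (real (Suc r) *
      (\<integral>x. indicator (PiE I S) x * (v (level_set I s x) * level_integral I v s x ^ r) \<partial>(\<Pi>\<^sub>M i\<in>I. lborel))) \<partial>lborel)"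
proof -
  let ?P = "(\<Pi>\<^sub>M i\<in>I. lborel) :: (nat \<Rightarrow> real) measure"
  interpret P: sigma_finite_measure ?P
    by (rule lborel_PiM.sigma_finite[OF I])
  interpret pair_sigma_finite ?P "lborel :: real measure" ..
  define f where "f x s = indicator (PiE I S) x * (indicator {t..1} s * (real (Suc r) * (v (level_set I s x) * level_integral I v s x ^ r)))"
    for x s
  let ?K = "\<Sum>E\<in>Pow I. \<bar>v E\<bar>"
  have box: "PiE I S \<in> sets ?P" by (rule box_measurable[OF I S(1)])
  have f_meas: "case_prod f \<in> borel_measurable (?P \<Otimes>\<^sub>M lborel)"
  proof -
    note [measurable] = box measurable_level_set_pair[OF I, of v, unfolded case_prod_beta]
      measurable_level_integral[OF I, of v, unfolded case_prod_beta]
    show ?thesis unfolding f_def case_prod_beta by measurable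
  qed
  have bound: "\<bar>f x s\<bar> \<le> real (Suc r) * (?K * ?K ^ r)" if "x \<in> PiE I S" "s \<in> {t..1}" for x s
    unfolding f_def abs_mult power_abs using that I t
    by (simp del: of_nat_Suc)
      (intro mult_mono power_mono abs_level_set_le abs_level_integral_le, auto intro!: mult_nonneg_nonneg sum_nonneg)
  have "integrable (?P \<Otimes>\<^sub>M lborel) (case_prod f)"
  proof (rule integrableI_bounded_set[where A = "PiE I S \<times> {t..1}" and B = "real (Suc r) * (?K * ?K ^ r)"])
    show "emeasure (?P \<Otimes>\<^sub>M lborel) (PiE I S \<times> {t..1}) < \<infinity>"
      using box box_emeasure[OF I S] by (subst lborel.emeasure_pair_measure_Times) (auto simp: ennreal_mult_less_top emeasure_lborel_Icc_eq)
    show "AE z in ?P \<Otimes>\<^sub>M lborel. z \<notin> PiE I S \<times> {t..1} \<longrightarrow> case_prod f z = 0"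
      by (rule AE_I2) (auto simp: f_def indicator_def)
    show "AE z in ?P \<Otimes>\<^sub>M lborel. z \<in> PiE I S \<times> {t..1} \<longrightarrow> norm (case_prod f z) \<le> real (Suc r) * (?K * ?K ^ r)"
      using bound by (intro AE_I2) (auto simp del: of_nat_Suc)
  qed (use box f_meas in auto)
  from Fubini_integral[OF this]
  have "(\<integral>s. (\<integral>x. f x s \<partial>?P) \<partial>lborel) = (\<integral>x. (\<integral>s. f x s \<partial>lborel) \<partial>?P)" .
  moreover have "(\<integral>s. f x s \<partial>lborel) = indicator (PiE I S) x * level_integral I v t x ^ Suc r" for x
    unfolding level_integral_power[OF I t] f_def by (rule integral_mult_right_zero)
  moreover have "(\<integral>x. f x s \<partial>?P) = indicator {t..1} s * (real (Suc r) *
      (\<integral>x. indicator (PiE I S) x * (v (level_set I s x) * level_integral I v s x ^ r) \<partial>?P))" for s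
    unfolding f_def by (simp only: integral_mult_right_zero[symmetric] mult.left_commute[of "indicator (PiE I S) _"])
  ultimately show ?thesis by simp
qed

text \<open>On this box the level set at threshold \<open>t\<close> is exactly \<open>D\<close>.
  Coordinates outside \<open>D\<close> lie below \<open>t\<close>, never enter the tail integral and
  contribute only the lengths of their sides.\<close>

lemma box_integral:
  assumes I: "finite I" and D: "D \<subseteq> I" and t: "0 \<le> t" "t \<le> 1"
    and SD: "\<And>i. i \<in> D \<Longrightarrow> S i = {t..1}"
    and SI: "\<And>i. i \<in> I - D \<Longrightarrow> S i \<in> sets borel" "\<And>i. i \<in> I - D \<Longrightarrow> S i \<subseteq> {0..<t}"
  shows "(\<integral>x. indicator (PiE I S) x * level_integral I v t x ^ r \<partial>(\<Pi>\<^sub>M i\<in>I. lborel)) =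
    (\<Prod>i\<in>I - D. measure lborel (S i)) *
      ((1 - t) ^ (card D + r) * chain_sum v r D / real ((card D + r) choose r))"
  using D t SD SI
\<comment> \<open>The induction hypothesis is applied to a subset of \<open>D\<close>, a higher
  threshold and a smaller box.\<close>
proof (induction r arbitrary: D t S)
  case 0
  have [measurable]: "S i \<in> sets borel" if "i \<in> I" for i using 0 that by (cases "i \<in> D") auto
  note t = \<open>0 \<le> t\<close> \<open>t \<le> 1\<close>
  have sub: "S i \<subseteq> {0..1}" if "i \<in> I" for i
  proof (cases "i \<in> D")
    case True
    then show ?thesis using 0(4)[of i] t by simp
  next
    case False
    then have "S i \<subseteq> {0..<t}" using 0(6) that by simp
    then show ?thesis using t by force
  qed
  have "(\<integral>x. indicator (PiE I S) x \<partial>(\<Pi>\<^sub>M i\<in>I. lborel)) = measure (\<Pi>\<^sub>M i\<in>I. lborel) (PiE I S)"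
    using box_measurable[OF I, of S] sets.sets_into_space[OF box_measurable[OF I, of S]]
    by (simp add: Int_absorb2)
  also have "\<dots> = (\<Prod>i\<in>I. measure lborel (S i))"
    using box_emeasure[OF I, of S] sub by (simp add: measure_def[of "PiM _ _"] prod_nonneg)
  also have "\<dots> = (\<Prod>i\<in>D. measure lborel (S i)) * (\<Prod>i\<in>I - D. measure lborel (S i))"
    using prod.subset_diff[OF \<open>D \<subseteq> I\<close> I] by (simp add: mult.commute)
  also have "(\<Prod>i\<in>D. measure lborel (S i)) = (1 - t) ^ card D"
    using 0 by simp
  finally show ?case by simp
next
  case (Suc r)
  note t = \<open>0 \<le> t\<close> \<open>t \<le> 1\<close>
  have finD: "finite D" using Suc.prems(1) I by (rule finite_subset)
  have Sm: "S i \<in> sets borel" if "i \<in> I" for i using Suc.prems that by (cases "i \<in> D") auto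
  have sub: "S i \<subseteq> {0..1}" if "i \<in> I" for i
  proof (cases "i \<in> D")
    case True
    then show ?thesis using Suc.prems(4)[of i] t by simp
  next
    case False
    then have "S i \<subseteq> {0..<t}" using Suc.prems(6) that by simp
    then show ?thesis using t by force
  qed
  let ?P = "(\<Pi>\<^sub>M i\<in>I. lborel) :: (nat \<Rightarrow> real) measure"
  let ?c = "\<Prod>i\<in>I - D. measure lborel (S i)"
  \<comment> \<open>\<open>T s E\<close> is the part of the box on which the level set at
    \<open>s\<close> is \<open>E\<close>: coordinates in \<open>E\<close> stay at or above
    \<open>s\<close>, those in \<open>D - E\<close> lie between \<open>t\<close> and
    \<open>s\<close>, the others keep their sides. The half-open sides make these parts disjoint, so
    the split is exact.\<close>
  define T where "T s E i = (if i \<in> E then {s..1} else if i \<in> D then {t..<s} else S i)" for s E i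
  define w where "w E = v E * chain_sum v r E / real ((card E + r) choose r)" for E
  have inner: "(\<integral>x. indicator (PiE I S) x * (v (level_set I s x) * level_integral I v s x ^ r) \<partial>?P) =
      (\<Sum>E\<in>Pow D. ?c * w E * ((s - t) ^ (card D - card E) * (1 - s) ^ (card E + r)))"
    if s: "s \<in> {t..1}" for s
  proof -
    have split: "indicator (PiE I S) x * v (level_set I s x) = (\<Sum>E\<in>Pow D. v E * indicator (PiE I (T s E)) x)" for x
    proof -
      have "indicator (PiE I (T s E)) x = (if level_set I s x = E then indicator (PiE I S) x else 0 :: real)"
        if E: "E \<in> Pow D" for E
      proof -
        have "x i \<in> T s E i \<longleftrightarrow> x i \<in> S i \<and> (s \<le> x i \<longleftrightarrow> i \<in> E)" if "i \<in> I" for i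
        proof (cases "i \<in> D")
          case True
          then show ?thesis using E Suc.prems(4)[OF True] s by (auto simp: T_def)
        next
          case False
          then have "S i \<subseteq> {0..<t}" using Suc.prems(6) that by simp
          then show ?thesis using False E s by (force simp: T_def)
        qed
        moreover have "level_set I s x = E \<longleftrightarrow> (\<forall>i\<in>I. s \<le> x i \<longleftrightarrow> i \<in> E)"
          using E Suc.prems(1) by (auto simp: level_set_def)
        ultimately have "x \<in> PiE I (T s E) \<longleftrightarrow> level_set I s x = E \<and> x \<in> PiE I S"
          by (auto simp: PiE_iff)
        then show ?thesis by (auto simp: indicator_def)
      qed
      then have "(\<Sum>E\<in>Pow D. v E * indicator (PiE I (T s E)) x) =
          (\<Sum>E\<in>Pow D. if level_set I s x = E then v E * indicator (PiE I S) x else 0)"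
        by (intro sum.cong refl) auto
      also have "\<dots> = (if level_set I s x \<in> Pow D then v (level_set I s x) * indicator (PiE I S) x else 0)"
        using finD by (subst sum.delta') auto
      also have "\<dots> = indicator (PiE I S) x * v (level_set I s x)"
      \<comment> \<open>No level set outside \<open>Pow D\<close> occurs on the box: coordinates
        outside \<open>D\<close> are below \<open>t\<close>, hence below \<open>s\<close>.\<close>
      proof (cases "x \<in> PiE I S")
        case True
        then have "x i < s" if "i \<in> I - D" for i
          using Suc.prems(6)[OF that] that s by (force simp: PiE_iff)
        then have "level_set I s x \<subseteq> D" by (force simp: level_set_def)
        then show ?thesis by simp
      qed simp
      finally show ?thesis ..
    qed
    have T1: "T s E i \<in> sets borel" "T s E i \<subseteq> {0..1}" if "i \<in> I" "E \<in> Pow D" for i E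
      using Sm sub[of i] that s t by (auto simp: T_def)
    have "(\<integral>x. indicator (PiE I S) x * (v (level_set I s x) * level_integral I v s x ^ r) \<partial>?P) =
        (\<integral>x. (\<Sum>E\<in>Pow D. v E * (indicator (PiE I (T s E)) x * level_integral I v s x ^ r)) \<partial>?P)"
      unfolding mult.assoc[symmetric] split sum_distrib_right ..
    also have "\<dots> = (\<Sum>E\<in>Pow D. v E * (\<integral>x. indicator (PiE I (T s E)) x * level_integral I v s x ^ r \<partial>?P))"
    proof -
      have "integrable ?P (\<lambda>x. indicator (PiE I (T s E)) x * level_integral I v s x ^ r)" if "E \<in> Pow D" for E
        using T1[OF _ that] s t by (intro box_integrable I) auto
      then show ?thesis
        by (subst Bochner_Integration.integral_sum) auto
    qed
    also have "\<dots> = (\<Sum>E\<in>Pow D. ?c * w E * ((s - t) ^ (card D - card E) * (1 - s) ^ (card E + r)))"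
    proof (intro sum.cong refl)
      fix E assume E: "E \<in> Pow D"
      have lower: "T s E i \<subseteq> {0..<s}" if "i \<in> I - E" for i
      proof (cases "i \<in> D")
        case True
        then show ?thesis using that t by (auto simp: T_def)
      next
        case False
        then have "S i \<subseteq> {0..<t}" using Suc.prems(6) that by simp
        then show ?thesis using False that s by (force simp: T_def)
      qed
      have "(\<integral>x. indicator (PiE I (T s E)) x * level_integral I v s x ^ r \<partial>?P) =
          (\<Prod>i\<in>I - E. measure lborel (T s E i)) * ((1 - s) ^ (card E + r) * chain_sum v r E / real ((card E + r) choose r))"
      proof (rule Suc.IH)
        show "E \<subseteq> I" "0 \<le> s" "s \<le> 1" using E Suc.prems(1) s t by auto
        show "T s E i = {s..1}" if "i \<in> E" for i using that by (simp add: T_def)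
      qed (use T1(1) E lower in auto)
      \<comment> \<open>The coordinates outside \<open>E\<close> are those outside \<open>D\<close>,
        with unchanged sides, and those in \<open>D - E\<close>, with sides of length
        \<open>s - t\<close>.\<close>
      also have "(\<Prod>i\<in>I - E. measure lborel (T s E i)) = ?c * (\<Prod>i\<in>D - E. measure lborel (T s E i))"
      proof -
        have "I - E - (D - E) = I - D" using E by auto
        moreover have "D - E \<subseteq> I - E" using Suc.prems(1) by auto
        moreover have "(\<Prod>i\<in>I - D. measure lborel (T s E i)) = ?c"
          using E by (intro prod.cong) (auto simp: T_def)
        ultimately show ?thesis using prod.subset_diff[of "D - E" "I - E" "\<lambda>i. measure lborel (T s E i)"] I by simp
      qed
      also have "(\<Prod>i\<in>D - E. measure lborel (T s E i)) = (s - t) ^ (card D - card E)"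
        using E finD s card_Diff_subset[of E D] by (auto simp: T_def finite_subset)
      finally show "v E * (\<integral>x. indicator (PiE I (T s E)) x * level_integral I v s x ^ r \<partial>?P) =
          ?c * w E * ((s - t) ^ (card D - card E) * (1 - s) ^ (card E + r))"
        by (simp add: w_def)
    qed
    finally show ?thesis .
  qed
  have "(\<integral>x. indicator (PiE I S) x * level_integral I v t x ^ Suc r \<partial>?P) =
      (\<integral>s. (\<Sum>E\<in>Pow D. real (Suc r) * ?c * w E *
        ((s - t) ^ (card D - card E) * (1 - s) ^ (card E + r) * indicator {t..1} s)) \<partial>lborel)"
  proof (rule trans[OF box_Fubini[OF I Sm sub t]])
    \<comment> \<open>\<open>inner\<close> covers only thresholds in \<open>{t..1}\<close>;
      elsewhere the indicator annihilates both sides.\<close>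
    have "indicator {t..1} s * (real (Suc r) *
        (\<integral>x. indicator (PiE I S) x * (v (level_set I s x) * level_integral I v s x ^ r) \<partial>?P)) =
      (\<Sum>E\<in>Pow D. real (Suc r) * ?c * w E *
        ((s - t) ^ (card D - card E) * (1 - s) ^ (card E + r) * indicator {t..1} s))" for s
    proof (cases "s \<in> {t..1}")
      case True
      then show ?thesis
        unfolding inner[OF True] by (simp add: sum_distrib_left mult.assoc del: of_nat_Suc)
    qed simp
    then show "(\<integral>s. indicator {t..1} s * (real (Suc r) *
        (\<integral>x. indicator (PiE I S) x * (v (level_set I s x) * level_integral I v s x ^ r) \<partial>?P)) \<partial>lborel) =
      (\<integral>s. (\<Sum>E\<in>Pow D. real (Suc r) * ?c * w E *
        ((s - t) ^ (card D - card E) * (1 - s) ^ (card E + r) * indicator {t..1} s)) \<partial>lborel)"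
      by (rule Bochner_Integration.integral_cong[OF refl])
  qed
  also have "\<dots> = (\<Sum>E\<in>Pow D. real (Suc r) * ?c * w E *
      (\<integral>s. (s - t) ^ (card D - card E) * (1 - s) ^ (card E + r) * indicator {t..1} s \<partial>lborel))"
  proof (subst Bochner_Integration.integral_sum)
    have "integrable lborel (\<lambda>s. (s - t) ^ a * (1 - s) ^ b * indicator {t..1} s)" for a b
      by (intro borel_integrable_atLeastAtMost) (auto intro!: continuous_intros)
    then show "integrable lborel (\<lambda>s. real (Suc r) * ?c * w E *
        ((s - t) ^ (card D - card E) * (1 - s) ^ (card E + r) * indicator {t..1} s))" for E
      by (rule integrable_mult_right)
  qed simp
  also have "\<dots> = (\<Sum>E\<in>Pow D. ?c * (1 - t) ^ (card D + Suc r) *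
      (v E / real (card D choose card E) * chain_sum v r E) / real ((card D + Suc r) choose Suc r))"
  \<comment> \<open>The Beta exponents count one \<open>s - t\<close> for each element of
    \<open>D - E\<close>, one \<open>1 - s\<close> for each element of \<open>E\<close>, and
    \<open>r\<close> further factors \<open>1 - s\<close> from the induction hypothesis.\<close>
  proof (intro sum.cong refl)
    fix E assume "E \<in> Pow D"
    then have le: "card E \<le> card D" using finD by (auto intro: card_mono)
    then have "card D - card E + (card E + r) + 1 = card D + Suc r" by simp
    then have "real (Suc r) * ?c * w E *
        (\<integral>s. (s - t) ^ (card D - card E) * (1 - s) ^ (card E + r) * indicator {t..1} s \<partial>lborel) =
       ?c * (1 - t) ^ (card D + Suc r) * (v E * chain_sum v r E) *
        (real (Suc r) * (fact (card D - card E) * fact (card E + r) / fact (card D - card E + (card E + r) + 1)) / real ((card E + r) choose r))"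
      unfolding beta_integral[OF t(2)] w_def by (simp add: mult_ac del: of_nat_Suc power_Suc fact_Suc)
    also have "\<dots> = ?c * (1 - t) ^ (card D + Suc r) *
      (v E / real (card D choose card E) * chain_sum v r E) / real ((card D + Suc r) choose Suc r)"
      unfolding chain_coefficient[OF le] by (simp del: power_Suc binomial_Suc_Suc)
    finally show "real (Suc r) * ?c * w E *
        (\<integral>s. (s - t) ^ (card D - card E) * (1 - s) ^ (card E + r) * indicator {t..1} s \<partial>lborel) =
      ?c * (1 - t) ^ (card D + Suc r) *
      (v E / real (card D choose card E) * chain_sum v r E) / real ((card D + Suc r) choose Suc r)" .
  qed
  also have "\<dots> = ?c * ((1 - t) ^ (card D + Suc r) * chain_sum v (Suc r) D / real ((card D + Suc r) choose Suc r))"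
    by (simp add: sum_distrib_left sum_divide_distrib mult.assoc del: power_Suc binomial_Suc_Suc)
  finally show ?case .
qed

section \<open>Moments of the uniform distribution on the cube\<close>

theorem proposition3:
  fixes n r :: nat
    and h :: "(nat \<Rightarrow> real) \<Rightarrow> real"
    and M :: "'a measure"
    and X :: "'a \<Rightarrow> nat \<Rightarrow> real"
  assumes "n \<ge> 1"
    and "r \<ge> 1"
    and "lincomb_lattice_polynomials n h"
    and "prob_space M"
    and "uniform_on_cube n M X"
  shows "integrable M (\<lambda>\<omega>. h (X \<omega>) ^ r) \<and>
    prob_space.expectation M (\<lambda>\<omega>. h (X \<omega>) ^ r) =
      1 / real ((n + r) choose r) *
      (\<Sum>A\<in>subset_chains n r.
        \<Prod>i=1..r. 1 / real (card (A (i - 1)) choose card (A i)) * set_fun n h (A i))"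
proof -
  let ?I = "{1..n}"
  let ?P = "(\<Pi>\<^sub>M i\<in>?I. lborel) :: (nat \<Rightarrow> real) measure"
  let ?v = "set_fun n h"
  let ?H = "level_integral ?I ?v 0"
  interpret prob_space M by fact
  have X [measurable]: "X \<in> M \<rightarrow>\<^sub>M ?P" and X_cube: "\<And>\<omega>. \<omega> \<in> space M \<Longrightarrow> X \<omega> \<in> cube n"
    and distr: "distr M ?P X = uniform_measure ?P (cube n)"
    using assms(5) by (auto simp: uniform_on_cube_def)
  \<comment> \<open>Measurability is obtained for \<open>?H\<close>, which is defined and measurable
    on the whole product space, while \<open>h\<close> is controlled only on the cube. As
    \<open>X\<close> takes all its values there, the two can be exchanged pointwise.\<close>
  have H [measurable]: "?H \<in> borel_measurable ?P" by measurable
  have hX: "h (X \<omega>) = ?H (X \<omega>)" if "\<omega> \<in> space M" for \<omega>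
    by (rule lincomb_eq_level_integral[OF assms(3) X_cube[OF that]])
  have cube: "cube n \<in> sets ?P" "emeasure ?P (cube n) = 1"
    unfolding cube_def by (auto intro!: box_measurable simp: lborel_PiM.emeasure_PiM)
  \<comment> \<open>The cube has volume 1, so its indicator is already the uniform density.\<close>
  have unif: "uniform_measure ?P (cube n) = density ?P (\<lambda>x. ennreal (indicator (cube n) x))"
    unfolding uniform_measure_def cube(2) by (simp add: ennreal_indicator divide_ennreal_def)
  have "integrable M (\<lambda>\<omega>. ?H (X \<omega>) ^ r)"
  proof (rule integrable_const_bound[where B = "(\<Sum>E\<in>Pow ?I. \<bar>?v E\<bar>) ^ r"])
    show "(\<lambda>\<omega>. ?H (X \<omega>) ^ r) \<in> borel_measurable M"
      by (intro borel_measurable_power measurable_compose[OF X H])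
  qed (auto simp: power_abs intro!: power_mono abs_level_integral_le)
  then have int: "integrable M (\<lambda>\<omega>. h (X \<omega>) ^ r)"
    by (simp add: hX cong: Bochner_Integration.integrable_cong)
  have "expectation (\<lambda>\<omega>. h (X \<omega>) ^ r) = expectation (\<lambda>\<omega>. ?H (X \<omega>) ^ r)"
    by (intro Bochner_Integration.integral_cong) (auto simp: hX)
  also have "\<dots> = (\<integral>x. ?H x ^ r \<partial>distr M ?P X)"
    by (intro integral_distr[symmetric] X borel_measurable_power H)
  also have "\<dots> = (\<integral>x. indicator (PiE ?I (\<lambda>_. {0..1})) x * ?H x ^ r \<partial>?P)"
    unfolding distr unif using cube(1) by (subst integral_density) (auto simp: cube_def)
  \<comment> \<open>The cube is the box with \<open>D\<close> the full index set and
    \<open>t = 0\<close>: the product over \<open>I - D\<close> is empty and the power of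
    \<open>1 - t\<close> equals 1.\<close>
  also have "\<dots> = chain_sum ?v r ?I / real ((n + r) choose r)"
    using box_integral[of ?I ?I 0 "\<lambda>_. {0..1}" ?v r] by simp
  also have "\<dots> = 1 / real ((n + r) choose r) *
      (\<Sum>A\<in>subset_chains n r. \<Prod>i=1..r. 1 / real (card (A (i - 1)) choose card (A i)) * ?v (A i))"
    using sum_chains_below[of ?I ?v r] by (simp add: subset_chains_def chains_below_def)
  finally show ?thesis using int by simp
qed

end
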